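(* Every polynomial in $\mathcal{LP}_{4,4}$ belongs to the same isotopism class; that is, any two polynomials in $\mathcal{LP}_{4,4}$ are isotopic.
   Context: $\mathbb{F}_4$ is the field with four elements. $\mathcal{P}_4$ is the set of polynomials in $\mathbb{F}_4[x]$ of degree less than $4$ that act as permutations of $\mathbb{F}_4$. $\mathcal{LP}_4$ is the set of polynomials $f\in\mathbb{F}_4[x,y]$ of degree less than $4$ in each variable such that, for every $a\in\mathbb{F}_4$, both $f(x,a)$ and $f(a,x)$ act as permutations of $\mathbb{F}_4$. $\mathcal{LP}_{4,4}$ is the subset of polynomials of total degree $4$ in $\mathcal{LP}_4$. A polynomial $f\in\mathcal{LP}_4$ is isotopic to $g\in\mathcal{LP}_4$ if $g(h_1(x),h_2(y))=h_3(f(x,y))$ for some $h_1,h_2,h_3\in\mathcal{P}_4$, compositions being taken modulo $x^4-x$ and $y^4-y$; this is an equivalence relation, whose classes are called isotopism classes. *)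

theory Defs
  imports "HOL-Computational_Algebra.Computational_Algebra"
begin

text \<open>
  The polynomial ring \<open>F[x,y]\<close> is rendered as \<open>F[x][y]\<close>, the type \<open>'a poly poly\<close>: the outer
  variable is \<open>y\<close>, and the coefficient of \<open>x^i * y^j\<close> in \<open>f\<close> is \<open>coeff (coeff f j) i\<close>.
  The number 4 below is the cardinality of the ground field, which is fixed in the theorem.
\<close>

definition poly_in_x :: "'a::field poly \<Rightarrow> 'a poly poly" where
  "poly_in_x h = [:h:]"

definition poly_in_y :: "'a::field poly \<Rightarrow> 'a poly poly" where
  "poly_in_y h = map_poly (\<lambda>c. [:c:]) h"

abbreviation var_x :: "'a::field poly poly" where
  "var_x \<equiv> poly_in_x [:0, 1:]"

abbreviation var_y :: "'a::field poly poly" where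
  "var_y \<equiv> poly_in_y [:0, 1:]"

definition eval2 :: "'a::field poly poly \<Rightarrow> 'a \<Rightarrow> 'a \<Rightarrow> 'a" where
  "eval2 f a b = poly (poly f [:b:]) a"

definition degree_x :: "'a::field poly poly \<Rightarrow> nat" where
  "degree_x f = Max (insert 0 {i. \<exists>j. coeff (coeff f j) i \<noteq> 0})"

definition degree_y :: "'a::field poly poly \<Rightarrow> nat" where
  "degree_y f = Max (insert 0 {j. \<exists>i. coeff (coeff f j) i \<noteq> 0})"

definition total_degree :: "'a::field poly poly \<Rightarrow> nat" where
  "total_degree f = Max (insert 0 {i + j | i j. coeff (coeff f j) i \<noteq> 0})"

definition P4 :: "'a::field poly set" where
  "P4 = {h. degree h < 4 \<and> bij (poly h)}"

definition LP4 :: "'a::field poly poly set" where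
  "LP4 = {f. degree_x f < 4 \<and> degree_y f < 4 \<and>
     (\<forall>a. bij (\<lambda>x. eval2 f x a) \<and> bij (\<lambda>x. eval2 f a x))}"

definition LP44 :: "'a::field poly poly set" where
  "LP44 = {f \<in> LP4. total_degree f = 4}"

text \<open>The formal compositions \<open>g(h\<^sub>1(x), h\<^sub>2(y))\<close> and \<open>h\<^sub>3(f(x,y))\<close> in \<open>F[x,y]\<close>.\<close>

definition subst_xy :: "'a::field poly poly \<Rightarrow> 'a poly \<Rightarrow> 'a poly \<Rightarrow> 'a poly poly" where
  "subst_xy g h1 h2 = pcompose (map_poly (\<lambda>p. pcompose p h1) g) (poly_in_y h2)"

definition subst_into :: "'a::field poly \<Rightarrow> 'a poly poly \<Rightarrow> 'a poly poly" where
  "subst_into h f = poly (map_poly (\<lambda>c. [:[:c:]:]) h) f"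

text \<open>Congruence modulo the ideal generated by \<open>x^4 - x\<close> and \<open>y^4 - y\<close>.\<close>

definition cong_xy :: "'a::field poly poly \<Rightarrow> 'a poly poly \<Rightarrow> bool" where
  "cong_xy p q \<longleftrightarrow>
     (\<exists>u v. p - q = u * (var_x ^ 4 - var_x) + v * (var_y ^ 4 - var_y))"

definition isotopic :: "'a::field poly poly \<Rightarrow> 'a poly poly \<Rightarrow> bool" where
  "isotopic f g \<longleftrightarrow>
     (\<exists>h1\<in>P4. \<exists>h2\<in>P4. \<exists>h3\<in>P4. cong_xy (subst_xy g h1 h2) (subst_into h3 f))"

definition isotopism_rel :: "('a::field poly poly \<times> 'a poly poly) set" where
  "isotopism_rel = {(f, g). f \<in> LP4 \<and> g \<in> LP4 \<and> isotopic f g}"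

definition isotopism_classes :: "'a::field poly poly set set" where
  "isotopism_classes = LP4 // isotopism_rel"

end

theory Submission
  imports Defs
begin

text \<open>
  For \<open>f\<close> in \<open>LP44\<close> the degree of \<open>f\<close> in each variable is at most 2, because the values of a
  permutation polynomial sum to zero. Hence total degree 4 means that the coefficient of
  \<open>x^2 * y^2\<close>, which equals \<open>\<Sum>x y. x * y * f(x, y)\<close>, is nonzero. If every row of the Latin square
  of \<open>f\<close> differed from the first row by an involution of the symbols, then, fixed-point-free
  involutions of a 4-element field being translations, \<open>f(x, y) = f(0, y) + t(x)\<close> and that sum would
  vanish. So some row differs from the first one by a 4-cycle, and this forces the square to be the
  Cayley table of \<open>\<int>/4\<close> up to relabelling rows, columns and symbols. Any two such squares are
  isotopic, and the relabellings are interpolated by polynomials.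
\<close>

section \<open>Finite fields and polynomial functions\<close>

text \<open>Multiplication by \<open>x\<close> permutes the nonzero elements, so their product
  equals \<open>x ^ (q - 1)\<close> times itself, where q is the size of the field; being nonzero,
  it cancels.\<close>

lemma finite_field_power_card_minus_1:
  fixes x :: "'a::{field,finite}"
  assumes "x \<noteq> 0"
  shows "x ^ (card (UNIV :: 'a set) - 1) = 1"
proof -
  let ?S = "UNIV - {0 :: 'a}"
  have "(\<Prod>y\<in>?S. y) = (\<Prod>y\<in>?S. x * y)"
    by (rule prod.reindex_bij_witness[of _ "\<lambda>y. x * y" "\<lambda>y. y / x"]) (use assms in auto)
  also have "\<dots> = x ^ card ?S * (\<Prod>y\<in>?S. y)"
    by (simp add: prod.distrib)
  finally have "x ^ card ?S = 1"
    by simp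
  then show ?thesis
    by (simp add: card_Diff_singleton)
qed

lemma finite_field_power_card:
  fixes x :: "'a::{field,finite}"
  shows "x ^ card (UNIV :: 'a set) = x"
proof (cases "x = 0")
  case True
  then show ?thesis
    by (simp add: finite_UNIV_card_ge_0)
next
  case False
  have "card (UNIV :: 'a set) = Suc (card (UNIV :: 'a set) - 1)"
    by (simp add: finite_UNIV_card_ge_0)
  then have "x ^ card (UNIV :: 'a set) = x * x ^ (card (UNIV :: 'a set) - 1)"
    by (metis power_Suc)
  then show ?thesis
    using finite_field_power_card_minus_1[OF False] by simp
qed

text \<open>Translation by 1 permutes the field, so adding 1 to every element leaves the total
  unchanged.\<close>

lemma of_nat_card_UNIV_eq_0:
  "of_nat (card (UNIV :: 'a set)) = (0 :: 'a::{field,finite})"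
proof -
  have "(\<Sum>x\<in>(UNIV :: 'a set). x) = (\<Sum>x\<in>UNIV. x + 1)"
    by (rule sum.reindex_bij_witness[of _ "\<lambda>x. x + 1" "\<lambda>x. x - 1"]) auto
  then show ?thesis
    by (simp add: sum.distrib)
qed

lemma poly_eq_0_of_vanishing:
  fixes p :: "'a::{field,finite} poly"
  assumes "degree p < card (UNIV :: 'a set)" and "\<And>x. poly p x = 0"
  shows "p = 0"
  by (rule poly_eqI_degree[where A = UNIV]) (use assms in auto)

lemma interpolation_finite_field:
  fixes h :: "'a::{field,finite} \<Rightarrow> 'a"
  obtains p where "degree p < card (UNIV :: 'a set)" and "poly p = h"
proof -
  let ?n = "card (UNIV :: 'a set) - 1"
  \<comment> \<open>By Fermat, \<open>1 - (x - a) ^ ?n\<close> is the indicator function of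
    \<open>x = a\<close>; at \<open>x = a\<close> this uses that \<open>?n\<close> is
    positive.\<close>
  define p where "p = (\<Sum>a\<in>UNIV. smult (h a) (1 - [:- a, 1:] ^ ?n))"
  have n: "?n < card (UNIV :: 'a set)"
    by (simp add: finite_UNIV_card_ge_0)
  have "\<not> card (UNIV :: 'a set) \<le> 1"
    using card_mono[of UNIV "{0, 1 :: 'a}"] by simp
  then have n0: "0 < ?n"
    by simp
  have "degree ([:- a, 1:] ^ ?n) \<le> ?n" for a :: 'a
    using degree_power_le[of "[:- a, 1:]" ?n] by simp
  then have "degree p \<le> ?n"
    unfolding p_def
    by (intro degree_sum_le degree_smult_le[THEN order_trans] degree_diff_le) auto
  moreover have "poly p x = h x" for x
  proof -
    have "h a * (1 - (x - a) ^ ?n) = (if x = a then h a else 0)" for a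
      using n0 finite_field_power_card_minus_1[of "x - a"] by auto
    then show ?thesis
      by (simp add: p_def poly_sum poly_power)
  qed
  ultimately show thesis
    using that n by (metis ext le_less_trans)
qed

lemma poly_eq_sum_lessThan:
  fixes p :: "'a::comm_semiring_1 poly"
  assumes "degree p < n"
  shows "poly p x = (\<Sum>i<n. coeff p i * x ^ i)"
  unfolding poly_altdef
  by (rule sum.mono_neutral_left) (use assms in \<open>auto simp: coeff_eq_0\<close>)

section \<open>Power sums and extraction of coefficients over four elements\<close>

text \<open>Replacing x by c * x multiplies the k-th power sum by \<open>c ^ k\<close>, so it
  vanishes once \<open>c ^ k\<close> differs from 1; any c other than 0 and 1 serves for k = 1 and k
  = 2. For k = 3 each of the three nonzero elements contributes 1, and 3 = -1 because 4 = 0.\<close>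

lemma power_sums_card_4:
  assumes card4: "card (UNIV :: 'a::{field,finite} set) = 4"
  shows "(\<Sum>x\<in>UNIV. x :: 'a) = 0"
    and "(\<Sum>x\<in>UNIV. x ^ 2 :: 'a) = 0"
    and "(\<Sum>x\<in>UNIV. x ^ 3 :: 'a) = -1"
proof -
  have "card {0, 1 :: 'a} \<noteq> card (UNIV :: 'a set)"
    using card4 by simp
  then have "{0, 1 :: 'a} \<noteq> UNIV"
    by metis
  then obtain c :: 'a where c: "c \<noteq> 0" "c \<noteq> 1"
    by blast
  have "c ^ 3 = 1"
    using finite_field_power_card_minus_1[OF c(1)] card4 by simp
  then have c2: "c ^ 2 \<noteq> 1"
    using c(2) by (metis mult_1_right numeral_3_eq_3 numeral_2_eq_2 power_Suc)
  have scale: "c ^ k * (\<Sum>x\<in>UNIV. x ^ k) = (\<Sum>x\<in>UNIV. x ^ k)" for k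
    unfolding sum_distrib_left
    by (rule sum.reindex_bij_witness[of _ "\<lambda>x. x / c" "\<lambda>x. c * x"])
      (use c in \<open>auto simp: power_mult_distrib\<close>)
  show "(\<Sum>x\<in>UNIV. x :: 'a) = 0"
    using scale[of 1] c(2) by auto
  show "(\<Sum>x\<in>UNIV. x ^ 2 :: 'a) = 0"
    using scale[of 2] c2 by auto
  have "(\<Sum>x\<in>UNIV. x ^ 3 :: 'a) = (\<Sum>x\<in>UNIV - {0}. x ^ 3)"
    by (rule sum.mono_neutral_right) auto
  also have "\<dots> = (\<Sum>x\<in>UNIV - {0 :: 'a}. 1)"
    by (rule sum.cong) (use finite_field_power_card_minus_1[where 'a = 'a] card4 in auto)
  also have "\<dots> = of_nat 4 - 1"
    using card4 by (simp add: card_Diff_singleton)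
  also have "\<dots> = -1"
    using of_nat_card_UNIV_eq_0[where 'a = 'a] card4 by simp
  finally show "(\<Sum>x\<in>UNIV. x ^ 3 :: 'a) = -1" .
qed

text \<open>Only the cubes have a nonzero power sum, and constants sum to a multiple of 4 = 0, so
  summation isolates the cubic coefficient. Multiplying by x first puts the quadratic coefficient in
  that place, while \<open>x ^ 4 = x\<close> sends the cubic one to the linear term.\<close>

lemma sum_poly_card_4:
  fixes p :: "'a::{field,finite} poly"
  assumes card4: "card (UNIV :: 'a set) = 4" and deg: "degree p < 4"
  shows "(\<Sum>x\<in>UNIV. poly p x) = - coeff p 3"
    and "(\<Sum>x\<in>UNIV. x * poly p x) = - coeff p 2"
proof -
  have four: "(4 :: 'a) = 0"
    using of_nat_card_UNIV_eq_0[where 'a = 'a] card4 by simp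
  have p: "poly p x = coeff p 0 + coeff p 1 * x + coeff p 2 * x ^ 2 + coeff p 3 * x ^ 3" for x
    unfolding poly_eq_sum_lessThan[OF deg] by (simp add: eval_nat_numeral)
  have x4: "x * x ^ 3 = x" for x :: 'a
    using finite_field_power_card[of x] card4 by (simp add: eval_nat_numeral)
  have xp: "x * poly p x = coeff p 0 * x + coeff p 1 * x ^ 2 + coeff p 2 * x ^ 3 + coeff p 3 * x" for x
  proof -
    have "x * poly p x = coeff p 0 * x + coeff p 1 * x ^ 2 + coeff p 2 * x ^ 3 + coeff p 3 * (x * x ^ 3)"
      unfolding p by (simp add: algebra_simps power2_eq_square power3_eq_cube)
    then show ?thesis
      by (simp only: x4)
  qed
  show "(\<Sum>x\<in>UNIV. poly p x) = - coeff p 3"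
    unfolding p by (simp add: sum.distrib power_sums_card_4[OF card4] card4 four
        flip: sum_distrib_left)
  show "(\<Sum>x\<in>UNIV. x * poly p x) = - coeff p 2"
    unfolding xp by (simp add: sum.distrib power_sums_card_4[OF card4] flip: sum_distrib_left)
qed

section \<open>Bivariate polynomials as functions\<close>

text \<open>\<open>eval2\<close> specializes y first; this form specializes x first and leaves a
  polynomial in y.\<close>

lemma eval2_eq_poly_map_poly: "eval2 f a b = poly (map_poly (\<lambda>p. poly p a) f) b"
  unfolding eval2_def by (induction f) (simp_all add: map_poly_pCons)

lemma eval2_simps [simp]:
  "eval2 0 a b = 0"
  "eval2 (pCons c f) a b = poly c a + b * eval2 f a b"
  "eval2 (f + g) a b = eval2 f a b + eval2 g a b"
  "eval2 (f - g) a b = eval2 f a b - eval2 g a b"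
  "eval2 (f * g) a b = eval2 f a b * eval2 g a b"
  by (simp_all add: eval2_def)

lemma eval2_subst_xy: "eval2 (subst_xy g h1 h2) a b = eval2 g (poly h1 a) (poly h2 b)"
proof -
  have y: "eval2 (poly_in_y h2) a b = poly h2 b"
    unfolding poly_in_y_def by (induction h2) (simp_all add: map_poly_pCons)
  show ?thesis
    unfolding subst_xy_def
    by (induction g) (simp_all add: map_poly_pCons pcompose_pCons poly_pcompose y)
qed

lemma eval2_subst_into: "eval2 (subst_into h f) a b = poly h (eval2 f a b)"
  unfolding subst_into_def by (induction h) (simp_all add: map_poly_pCons)

lemma var_x_eq: "var_x ^ 4 - var_x = [:[:0, -1, 0, 0, 1:]:]"
  by (simp add: poly_in_x_def eval_nat_numeral)

lemma var_y_eq: "var_y ^ 4 - var_y = [:0, -1, 0, 0, 1:]"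
  by (simp add: poly_in_y_def map_poly_pCons eval_nat_numeral) (simp add: one_pCons)

section \<open>From identities of functions to congruences of polynomials\<close>

text \<open>Reducing by \<open>y^4 - y\<close>, and then each coefficient by \<open>x^4 - x\<close>,
  leaves a remainder of degree below 4 in both variables. It still vanishes at every point, which
  forces it to be zero.\<close>

lemma vanishing_in_ideal:
  fixes p :: "'a::{field,finite} poly poly"
  assumes card4: "card (UNIV :: 'a set) = 4" and van: "\<And>a b. eval2 p a b = 0"
  shows "\<exists>u v. p = u * (var_x ^ 4 - var_x) + v * (var_y ^ 4 - var_y)"
proof -
  define G :: "'a poly" where "G = [:0, -1, 0, 0, 1:]"
  define H :: "'a poly poly" where "H = [:0, -1, 0, 0, 1:]"
  have degH: "degree H = 4" and "H \<noteq> 0" and "coeff H 4 = 1"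
    by (simp_all add: H_def eval_nat_numeral)
  have degG: "degree G = 4" and "G \<noteq> 0"
    by (simp_all add: G_def)
  \<comment> \<open>The coefficients lie in the ring of polynomials in x, which is not a field,
    hence pseudo-division; as \<open>H\<close> is monic, no power of a leading coefficient
    appears.\<close>
  obtain v r where vr: "pseudo_divmod p H = (v, r)"
    by fastforce
  have pvr: "p = H * v + r" and degr: "r = 0 \<or> degree r < 4"
    using pseudo_divmod[OF \<open>H \<noteq> 0\<close> vr] degH \<open>coeff H 4 = 1\<close> by auto
  define u where "u = map_poly (\<lambda>c. c div G) r"
  define s where "s = map_poly (\<lambda>c. c mod G) r"
  have rus: "r = u * [:G:] + s"
    by (rule poly_eqI) (simp add: u_def s_def coeff_map_poly mult.commute[of _ "[:G:]"] mult.commute[of G])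
  have degs: "degree s < 4"
    using degr map_poly_degree_leq[of "\<lambda>c. c mod G" r] by (auto simp: s_def)
  have x4: "x ^ 4 = x" for x :: 'a
    using finite_field_power_card[of x] card4 by simp
  have "eval2 [:G:] a b = 0" and "eval2 H a b = 0" for a b
    using x4[of a] x4[of b] by (simp_all add: G_def H_def eval_nat_numeral algebra_simps)
  then have vans: "eval2 s a b = 0" for a b
    using van[of a b] unfolding pvr rus eval2_simps(3,5) by simp
  \<comment> \<open>For fixed \<open>a\<close> the remainder is a polynomial in y with more roots
    than its degree. Each of its coefficients, as a polynomial in x, then vanishes at every
    \<open>a\<close>, and the same root count applies again.\<close>
  have "map_poly (\<lambda>p. poly p a) s = 0" for a
  proof (rule poly_eq_0_of_vanishing)
    show "degree (map_poly (\<lambda>p. poly p a) s) < card (UNIV :: 'a set)"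
      using degs map_poly_degree_leq[of "\<lambda>p. poly p a" s] card4 by linarith
    show "poly (map_poly (\<lambda>p. poly p a) s) b = 0" for b
      using vans[of a b] by (simp add: eval2_eq_poly_map_poly)
  qed
  then have "poly (coeff s j) a = 0" for j a
    by (metis coeff_0 coeff_map_poly poly_0)
  moreover have "degree (coeff s j) < 4" for j
    using degree_mod_less[OF \<open>G \<noteq> 0\<close>, of "coeff r j"] degG
    by (auto simp: s_def coeff_map_poly)
  ultimately have "coeff s j = 0" for j
    using card4 by (intro poly_eq_0_of_vanishing) auto
  then have "s = 0"
    by (intro poly_eqI) simp
  then have "p = u * (var_x ^ 4 - var_x) + v * (var_y ^ 4 - var_y)"
    unfolding var_x_eq var_y_eq using pvr rus by (simp add: G_def H_def mult.commute)
  then show ?thesis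
    by blast
qed

text \<open>Interpolation turns the bijections into members of \<open>P4\<close>, and a pointwise
  identity gives the required congruence, so isotopism may be checked on functions.\<close>

lemma isotopicI:
  fixes f g :: "'a::{field,finite} poly poly"
  assumes card4: "card (UNIV :: 'a set) = 4"
    and "bij h1" "bij h2" "bij h3"
    and iso: "\<And>x y. eval2 g (h1 x) (h2 y) = h3 (eval2 f x y)"
  shows "isotopic f g"
proof -
  obtain p1 p2 p3 where "degree p1 < 4" "poly p1 = h1" "degree p2 < 4" "poly p2 = h2"
    "degree p3 < 4" "poly p3 = h3"
    using interpolation_finite_field[of h1] interpolation_finite_field[of h2]
      interpolation_finite_field[of h3] card4 by metis
  moreover from this have "cong_xy (subst_xy g p1 p2) (subst_into p3 f)"
    unfolding cong_xy_def
    by (intro vanishing_in_ideal[OF card4]) (simp add: eval2_subst_xy eval2_subst_into iso)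
  ultimately show ?thesis
    using assms(2-4) unfolding isotopic_def P4_def by blast
qed

section \<open>Latin squares of order 4\<close>

definition latin :: "('b \<Rightarrow> 'b \<Rightarrow> 'b) \<Rightarrow> bool" where
  "latin L \<longleftrightarrow> (\<forall>x. bij (L x)) \<and> (\<forall>y. bij (\<lambda>x. L x y))"

text \<open>The Cayley table of the integers modulo 4, with \<open>r\<close>, \<open>c\<close>,
  \<open>s\<close> labelling rows, columns and symbols.\<close>

definition cyclic_square :: "('b \<Rightarrow> 'b \<Rightarrow> 'b) \<Rightarrow> (nat \<Rightarrow> 'b) \<Rightarrow> (nat \<Rightarrow> 'b) \<Rightarrow> (nat \<Rightarrow> 'b) \<Rightarrow> bool" where
  "cyclic_square L r c s \<longleftrightarrow> bij_betw r {..<4} UNIV \<and> bij_betw c {..<4} UNIV \<and> bij_betw s {..<4} UNIV \<and>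
     (\<forall>i<4. \<forall>j<4. L (r i) (c j) = s ((i + j) mod 4))"

lemma latin_row_eq_iff: "latin L \<Longrightarrow> L x y = L x y' \<longleftrightarrow> y = y'"
  unfolding latin_def by (metis bij_def injD)

lemma latin_column_eq_iff: "latin L \<Longrightarrow> L x y = L x' y \<longleftrightarrow> x = x'"
  unfolding latin_def bij_def inj_def by metis

lemma latin_row_surj: "latin L \<Longrightarrow> \<exists>y. L x y = z"
  unfolding latin_def by (metis bij_pointE)

text \<open>Both squares are relabellings of the same table, so sending each label of the first
  square to the label of the second with the same index is an isotopism.\<close>

lemma cyclic_squares_isotopic:
  fixes L L' :: "'b \<Rightarrow> 'b \<Rightarrow> 'b"
  assumes "cyclic_square L r c s" and "cyclic_square L' r' c' s'"
  shows "\<exists>h1 h2 h3. bij h1 \<and> bij h2 \<and> bij h3 \<and> (\<forall>x y. L' (h1 x) (h2 y) = h3 (L x y))"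
proof -
  have relabel: "\<exists>h. bij h \<and> (\<forall>i<4. h (q i) = q' i)"
    if "bij_betw q {..<4} UNIV" "bij_betw q' {..<4} UNIV" for q q' :: "nat \<Rightarrow> 'b"
  proof (intro exI conjI allI impI)
    let ?h = "q' \<circ> the_inv_into {..<4} q"
    show "bij ?h"
      using that by (meson bij_betw_the_inv_into bij_betw_trans)
    show "?h (q i) = q' i" if "i < 4" for i
      using that \<open>bij_betw q {..<4} UNIV\<close> by (simp add: bij_betw_def the_inv_into_f_f)
  qed
  obtain h1 where h1: "bij h1" "\<forall>i<4. h1 (r i) = r' i"
    using relabel[of r r'] assms by (auto simp: cyclic_square_def)
  obtain h2 where h2: "bij h2" "\<forall>i<4. h2 (c i) = c' i"
    using relabel[of c c'] assms by (auto simp: cyclic_square_def)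
  obtain h3 where h3: "bij h3" "\<forall>i<4. h3 (s i) = s' i"
    using relabel[of s s'] assms by (auto simp: cyclic_square_def)
  have "L' (h1 x) (h2 y) = h3 (L x y)" for x y
  proof -
    obtain i where i: "i < 4" "x = r i"
      using assms(1) unfolding cyclic_square_def bij_betw_def by (metis UNIV_I imageE lessThan_iff)
    obtain j where j: "j < 4" "y = c j"
      using assms(1) unfolding cyclic_square_def bij_betw_def by (metis UNIV_I imageE lessThan_iff)
    show ?thesis
      using assms i j h1 h2 h3 by (simp add: cyclic_square_def)
  qed
  then show ?thesis
    using h1 h2 h3 by blast
qed

lemma card_4_cases:
  assumes "card (UNIV :: 'b set) = 4" and "distinct [a, b, c, d :: 'b]"
  shows "x = a \<or> x = b \<or> x = c \<or> x = d"
proof -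
  have "{a, b, c, d} = UNIV"
  proof (rule card_subset_eq)
    show "finite (UNIV :: 'b set)"
      using assms(1) card.infinite by fastforce
  qed (use assms in auto)
  then show ?thesis
    by blast
qed

lemma bij_betw_nth_card_4:
  assumes "card (UNIV :: 'b set) = 4" and "distinct [a, b, c, d :: 'b]"
  shows "bij_betw ((!) [a, b, c, d]) {..<4} UNIV"
proof -
  have "set [a, b, c, d] = UNIV"
    using card_4_cases[OF assms] by auto
  then show ?thesis
    using bij_betw_nth[OF assms(2), of "{..<4}" UNIV] by simp
qed

lemma fourth_element:
  assumes "card (UNIV :: 'b set) = 4" and "distinct [a, b, c :: 'b]"
  obtains d where "distinct [a, b, c, d]"
proof -
  have "card {a, b, c} = 3"
    using assms(2) by simp
  then have "{a, b, c} \<noteq> UNIV"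
    using assms(1) by force
  then obtain d where "d \<notin> {a, b, c}"
    by blast
  then show thesis
    using assms(2) by (intro that[of d]) auto
qed

lemma all_less_4: "(\<forall>i<4. P i) \<longleftrightarrow> P 0 \<and> P 1 \<and> P 2 \<and> P (3 :: nat)"
  by (auto simp: less_Suc_eq eval_nat_numeral)

section \<open>Latin squares with two rows that differ by a 4-cycle\<close>

text \<open>The permutation of symbols carrying row \<open>r0\<close> to row \<open>r1\<close> has
  no fixed point, and \<open>step\<close> and \<open>ninv\<close> say that its square moves
  \<open>L r0 c0\<close>. On four symbols it must be a 4-cycle, and the other two rows then arise
  from its square and its cube.\<close>

lemma cyclic_square_of_non_involution:
  fixes L :: "'b \<Rightarrow> 'b \<Rightarrow> 'b"
  assumes card4: "card (UNIV :: 'b set) = 4" and L: "latin L"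
    and step: "L r0 c1 = L r1 c0" and ninv: "L r1 c1 \<noteq> L r0 c0" and rows: "r0 \<noteq> r1"
  shows "\<exists>r c s. cyclic_square L r c s"
proof -
  note row = latin_row_eq_iff[OF L] and col = latin_column_eq_iff[OF L]
  define s0 s1 s2 where s_def: "s0 = L r0 c0" "s1 = L r0 c1" "s2 = L r1 c1"
  have "c0 \<noteq> c1"
    using step rows col by metis
  have s012: "s0 \<noteq> s1" "s1 \<noteq> s2" "s0 \<noteq> s2"
    using \<open>c0 \<noteq> c1\<close> step ninv row by (metis s_def)+
  obtain c2 where c2: "L r0 c2 = s2"
    using latin_row_surj[OF L] by blast
  have c012: "distinct [c0, c1, c2]"
    using \<open>c0 \<noteq> c1\<close> c2 s012 s_def by auto
  define s3 where "s3 = L r1 c2"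
  have s3: "s3 \<noteq> s1" "s3 \<noteq> s2"
    using c012 step row by (auto simp: s3_def s_def)
  \<comment> \<open>Otherwise \<open>s0\<close>, \<open>s1\<close>, \<open>s2\<close> would form a
    3-cycle and the fourth symbol would be fixed, making the two rows agree in a column.\<close>
  have "s3 \<noteq> s0"
  proof
    assume "s3 = s0"
    obtain c where c: "distinct [c0, c1, c2, c]"
      using fourth_element[OF card4 c012] .
    obtain s where s: "distinct [s0, s1, s2, s]"
      using fourth_element[OF card4, of s0 s1 s2] s012 by auto
    have "L r0 c \<notin> {s0, s1, s2}"
      using c row by (auto simp: s_def(1,2) c2[symmetric])
    moreover have "L r1 c \<notin> {s1, s2, s3}"
      using c step row by (auto simp: s_def s3_def)
    ultimately have "L r0 c = L r1 c"
      using card_4_cases[OF card4 s] \<open>s3 = s0\<close> by (metis insertI1 insertI2)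
    then show False
      using rows col by blast
  qed
  with s012 s3 have s: "distinct [s0, s1, s2, s3]"
    by auto
  obtain c3 where c3: "L r0 c3 = s3"
    using latin_row_surj[OF L] by blast
  have c: "distinct [c0, c1, c2, c3]"
    using c012 c2 c3 s s_def by auto
  have row0: "L r0 c0 = s0" "L r0 c1 = s1" "L r0 c2 = s2" "L r0 c3 = s3"
    by (simp_all add: s_def c2 c3)
  have row1: "L r1 c0 = s1" "L r1 c1 = s2" "L r1 c2 = s3"
    using step by (simp_all add: s_def s3_def)
  have "L r1 c3 \<notin> {s1, s2, s3}"
    using c row row1 by (metis distinct_length_2_or_more insertE singletonD)
  then have row1': "L r1 c3 = s0"
    using card_4_cases[OF card4 s] by blast
  \<comment> \<open>\<open>A\<close> and \<open>B\<close> describe row \<open>r0\<close> with its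
    symbols advanced by two and by three places along the cycle.\<close>
  define A where "A r \<longleftrightarrow> L r c0 = s2 \<and> L r c1 = s3 \<and> L r c2 = s0 \<and> L r c3 = s1" for r
  define B where "B r \<longleftrightarrow> L r c0 = s3 \<and> L r c1 = s0 \<and> L r c2 = s1 \<and> L r c3 = s2" for r
  have AB: "A r \<or> B r" if r: "r \<noteq> r0" "r \<noteq> r1" for r
  proof -
    have other: "L r c \<noteq> L r0 c" "L r c \<noteq> L r1 c" for c
      using r col by blast+
    \<comment> \<open>Rows \<open>r0\<close> and \<open>r1\<close> leave two candidates per column.
      Neighbouring columns share a candidate, so one choice determines the whole row.\<close>
    have "L r c0 = s2 \<or> L r c0 = s3" "L r c1 = s3 \<or> L r c1 = s0"
      "L r c2 = s0 \<or> L r c2 = s1" "L r c3 = s1 \<or> L r c3 = s2"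
      using card_4_cases[OF card4 s] other row0 row1 row1' by metis+
    moreover have "distinct [L r c0, L r c1, L r c2, L r c3]"
      using c row by auto
    ultimately show ?thesis
      unfolding A_def B_def using s by auto
  qed
  have "card {r0, r1} = 2"
    using rows by simp
  then have "{r0, r1} \<noteq> UNIV"
    using card4 by (metis numeral_eq_iff num.distinct(1) num.inject(1))
  then obtain r where "r \<noteq> r0" "r \<noteq> r1"
    by blast
  then obtain r' where r': "distinct [r0, r1, r, r']"
    using fourth_element[OF card4, of r0 r1 r] rows by auto
  \<comment> \<open>Two rows of the same type would agree in a column, so the remaining rows are one
    of each type.\<close>
  have "\<not> (A r \<and> A r')" "\<not> (B r \<and> B r')"
    using r' col by (auto simp: A_def B_def)
  then obtain r2 r3 where "A r2" "B r3" and r: "distinct [r0, r1, r2, r3]"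
    using AB[of r] AB[of r'] r' by auto
  then have "cyclic_square L ((!) [r0, r1, r2, r3]) ((!) [c0, c1, c2, c3]) ((!) [s0, s1, s2, s3])"
    unfolding cyclic_square_def
    using bij_betw_nth_card_4[OF card4 r] bij_betw_nth_card_4[OF card4 c]
      bij_betw_nth_card_4[OF card4 s] row0 row1 row1'
    by (simp add: A_def B_def all_less_4)
  then show ?thesis
    by blast
qed

section \<open>Latin squares whose rows differ by involutions\<close>

text \<open>Assumption \<open>inv\<close> says that the permutation carrying row \<open>x0\<close>
  to row \<open>x\<close> is an involution. For \<open>x\<close> other than \<open>x0\<close> it has
  no fixed point and splits the symbols into two pairs. All four symbols sum to 0 in characteristic
  2, so both pairs have the same sum, which is the translation vector.\<close>

lemma involutive_rows_translation:
  fixes L :: "'a::{field,finite} \<Rightarrow> 'a \<Rightarrow> 'a"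
  assumes card4: "card (UNIV :: 'a set) = 4" and L: "latin L"
    and inv: "\<And>x y y'. L x0 y' = L x y \<Longrightarrow> L x y' = L x0 y"
  shows "L x y - L x0 y = L x z - L x0 z"
proof (cases "x = x0")
  case False
  note row = latin_row_eq_iff[OF L] and col = latin_column_eq_iff[OF L]
  have four: "(4 :: 'a) = 0"
    using of_nat_card_UNIV_eq_0[where 'a = 'a] card4 by simp
  then have "(2 :: 'a) * 2 = 0"
    by simp
  then have two: "(2 :: 'a) = 0"
    by (metis mult_eq_0_iff)
  then have double: "a + a = 0" for a :: 'a
    by (metis mult_2 mult_zero_left)
  then have minus: "a - b = a + b" for a b :: 'a
    by (metis diff_add_cancel add.assoc add.right_neutral)
  \<comment> \<open>The columns \<open>y\<close> and \<open>y'\<close> exchange their symbols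
    between the two rows, and likewise \<open>z\<close> and \<open>z'\<close>.\<close>
  obtain y' where y': "L x0 y' = L x y"
    using latin_row_surj[OF L] by blast
  obtain z' where z': "L x0 z' = L x z"
    using latin_row_surj[OF L] by blast
  have yz: "L x y' = L x0 y" "L x z' = L x0 z" "y \<noteq> y'" "z \<noteq> z'"
    using inv y' z' False col by metis+
  show ?thesis
  proof (cases "z = y \<or> z = y'")
    case True
    then show ?thesis
      using y' yz by (auto simp: minus add.commute)
  next
    case z: False
    then have d: "distinct [y, y', z, z']"
      using y' z' yz row by auto
    have "bij (L x0)"
      using L by (simp add: latin_def)
    then have "(\<Sum>y\<in>UNIV. L x0 y) = (\<Sum>a\<in>UNIV. a)"
      by (rule sum.reindex_bij_betw)
    moreover have UNIV: "UNIV = {y, y', z, z'}"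
      using card_4_cases[OF card4 d] by auto
    have "(\<Sum>y\<in>UNIV. L x0 y) = L x0 y + L x0 y' + (L x0 z + L x0 z')"
      unfolding UNIV using d by (simp add: add.assoc)
    ultimately have "L x0 y + L x0 y' + (L x0 z + L x0 z') = 0"
      using power_sums_card_4(1)[OF card4] by simp
    then have "L x0 y + L x0 y' = L x0 z + L x0 z'"
      by (metis add_eq_0_iff double minus_unique)
    then show ?thesis
      using y' z' by (simp add: minus add.commute)
  qed
qed simp

text \<open>Without a 4-cycle from row 0 to another row, every row is a translate of row 0, so
  \<open>L x y\<close> is a function of y plus a function of x. The moment of each term contains the
  sum of all field elements as a factor, which is 0.\<close>

lemma cyclic_square_of_moment:
  fixes L :: "'a::{field,finite} \<Rightarrow> 'a \<Rightarrow> 'a"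
  assumes card4: "card (UNIV :: 'a set) = 4" and L: "latin L"
    and moment: "(\<Sum>y\<in>UNIV. y * (\<Sum>x\<in>UNIV. x * L x y)) \<noteq> 0"
  shows "\<exists>r c s. cyclic_square L r c s"
proof (rule ccontr)
  assume "\<not> ?thesis"
  \<comment> \<open>For \<open>x = 0\<close> the claim is the premise itself; for other rows a
    failure would produce a cyclic square.\<close>
  then have inv: "L x y' = L 0 y" if "L 0 y' = L x y" for x y y'
    using cyclic_square_of_non_involution[OF card4 L that] that by metis
  define t where "t x = L x 0 - L 0 0" for x
  have t: "L x y = L 0 y + t x" for x y
    using involutive_rows_translation[OF card4 L inv, of x y 0] by (simp add: t_def algebra_simps)
  have "(\<Sum>x\<in>UNIV. x * L x y) = (\<Sum>x\<in>UNIV. x * t x)" for y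
  proof -
    have "(\<Sum>x\<in>UNIV. x * L x y) = (\<Sum>x\<in>UNIV. x * L 0 y + x * t x)"
      by (rule sum.cong[OF refl], subst t, rule distrib_left)
    then show ?thesis
      by (simp add: sum.distrib power_sums_card_4(1)[OF card4] flip: sum_distrib_right)
  qed
  then have "(\<Sum>y\<in>UNIV. y * (\<Sum>x\<in>UNIV. x * L x y)) = 0"
    by (simp add: power_sums_card_4(1)[OF card4] flip: sum_distrib_right)
  then show False
    using moment by blast
qed

section \<open>Polynomials of total degree 4\<close>

text \<open>The degrees are defined by \<open>Max\<close>, whose properties require finite
  sets.\<close>

lemma finite_support2:
  fixes f :: "'a::field poly poly"
  shows "finite {(i, j). coeff (coeff f j) i \<noteq> 0}"
proof (rule finite_subset)
  show "{(i, j). coeff (coeff f j) i \<noteq> 0} \<subseteq>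
      (\<lambda>(j, i). (i, j)) ` (SIGMA j:{..degree f}. {..degree (coeff f j)})"
  proof clarify
    fix i j
    assume nz: "coeff (coeff f j) i \<noteq> 0"
    then have "coeff f j \<noteq> 0"
      by force
    with nz show "(i, j) \<in> (\<lambda>(j, i). (i, j)) ` (SIGMA j:{..degree f}. {..degree (coeff f j)})"
      by (intro image_eqI[of _ _ "(j, i)"]) (auto intro: le_degree)
  qed
qed auto

lemma coeff_eq_0_beyond_degree:
  fixes f :: "'a::field poly poly"
  shows "degree_x f < i \<Longrightarrow> coeff (coeff f j) i = 0"
    and "degree_y f < j \<Longrightarrow> coeff (coeff f j) i = 0"
proof -
  have "{i. \<exists>j. coeff (coeff f j) i \<noteq> 0} = fst ` {(i, j). coeff (coeff f j) i \<noteq> 0}"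
    by force
  then have fin: "finite {i. \<exists>j. coeff (coeff f j) i \<noteq> 0}"
    by (simp only: finite_imageI finite_support2)
  show "coeff (coeff f j) i = 0" if "degree_x f < i"
    using Max_ge[of "insert 0 {i. \<exists>j. coeff (coeff f j) i \<noteq> 0}" i] fin that
    unfolding degree_x_def by force
  have "{j. \<exists>i. coeff (coeff f j) i \<noteq> 0} = snd ` {(i, j). coeff (coeff f j) i \<noteq> 0}"
    by force
  then have fin: "finite {j. \<exists>i. coeff (coeff f j) i \<noteq> 0}"
    by (simp only: finite_imageI finite_support2)
  show "coeff (coeff f j) i = 0" if "degree_y f < j"
    using Max_ge[of "insert 0 {j. \<exists>i. coeff (coeff f j) i \<noteq> 0}" j] fin that
    unfolding degree_y_def by force
qed

text \<open>A nonzero maximum cannot be the inserted default 0, so it comes from a monomial of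
  \<open>f\<close>.\<close>

lemma total_degree_attained:
  fixes f :: "'a::field poly poly"
  assumes "total_degree f \<noteq> 0"
  obtains i j where "i + j = total_degree f" and "coeff (coeff f j) i \<noteq> 0"
proof -
  have "{i + j | i j. coeff (coeff f j) i \<noteq> 0} =
      (\<lambda>(i, j). i + j) ` {(i, j). coeff (coeff f j) i \<noteq> 0}"
    by force
  then have "finite (insert 0 {i + j | i j. coeff (coeff f j) i \<noteq> 0})"
    by (simp only: finite_imageI finite_insert finite_support2)
  then have "total_degree f \<in> insert 0 {i + j | i j. coeff (coeff f j) i \<noteq> 0}"
    unfolding total_degree_def by (rule Max_in) auto
  then show thesis
    using assms that by auto
qed

lemma moment_of_LP44:
  fixes f :: "'a::{field,finite} poly poly"
  assumes card4: "card (UNIV :: 'a set) = 4" and f: "f \<in> LP44"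
  shows "(\<Sum>y\<in>UNIV. y * (\<Sum>x\<in>UNIV. x * eval2 f x y)) \<noteq> 0"
proof -
  \<comment> \<open>\<open>C i\<close> is the coefficient of \<open>x^i\<close> in \<open>f\<close>,
    as a polynomial in y.\<close>
  define C where "C i = map_poly (\<lambda>p. coeff p i) f" for i
  have coeffC: "coeff (C i) j = coeff (coeff f j) i" for i j
    by (simp add: C_def coeff_map_poly)
  have polyC: "coeff (poly f [:b:]) i = poly (C i) b" for b i
    unfolding C_def by (induction f) (simp_all add: map_poly_pCons)
  have big: "coeff (coeff f j) i = 0" if "4 \<le> i \<or> 4 \<le> j" for i j
    using that f coeff_eq_0_beyond_degree[of f] by (auto simp: LP44_def LP4_def)
  have deg: "degree p < 4" if "\<And>i. 4 \<le> i \<Longrightarrow> coeff p i = 0" for p :: "'a poly"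
    using that by (metis degree_0 leading_coeff_0_iff not_le zero_less_numeral)
  have degx: "degree (poly f [:b:]) < 4" for b
    by (rule deg) (metis polyC C_def big coeffC leading_coeff_0_iff poly_0)
  have degy: "degree (map_poly (\<lambda>p. poly p a) f) < 4" for a
  proof (rule deg)
    fix j :: nat
    assume "4 \<le> j"
    then have "coeff f j = 0"
      using big by (intro poly_eqI) simp
    then show "coeff (map_poly (\<lambda>p. poly p a) f) j = 0"
      by (simp add: coeff_map_poly)
  qed
  have degC: "degree (C i) < 4" for i
    by (rule deg) (simp add: coeffC big)
  have bijx: "bij (\<lambda>x. eval2 f x b)" and bijy: "bij (eval2 f b)" for b
    using f by (auto simp: LP44_def LP4_def)
  \<comment> \<open>The values of the permutation x \<mapsto> f(x, b) sum to 0, and this sum is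
    minus its cubic coefficient.\<close>
  have "poly (C 3) b = 0" for b
  proof -
    have "- poly (C 3) b = (\<Sum>x\<in>UNIV. eval2 f x b)"
      unfolding eval2_def sum_poly_card_4(1)[OF card4 degx] polyC ..
    also have "\<dots> = 0"
      using sum.reindex_bij_betw[OF bijx, of "\<lambda>x. x"] power_sums_card_4(1)[OF card4] by simp
    finally show ?thesis
      by simp
  qed
  then have "C 3 = 0"
    using degC card4 by (intro poly_eq_0_of_vanishing) auto
  then have x3: "coeff (coeff f j) 3 = 0" for j
    by (metis coeffC coeff_0)
  have "poly (coeff f 3) a = 0" for a
  proof -
    have "- poly (coeff f 3) a = (\<Sum>y\<in>UNIV. eval2 f a y)"
      unfolding eval2_eq_poly_map_poly sum_poly_card_4(1)[OF card4 degy] by (simp add: coeff_map_poly)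
    also have "\<dots> = 0"
      using sum.reindex_bij_betw[OF bijy, of "\<lambda>x. x"] power_sums_card_4(1)[OF card4] by simp
    finally show ?thesis
      by simp
  qed
  moreover have "degree (coeff f 3) < 4"
    by (rule deg) (simp add: big)
  ultimately have y3: "coeff f 3 = 0"
    using card4 by (intro poly_eq_0_of_vanishing) auto
  obtain i j where ij: "i + j = 4" "coeff (coeff f j) i \<noteq> 0"
    using total_degree_attained[of f] f by (auto simp: LP44_def)
  \<comment> \<open>Exponents up to 2 with sum 4 must both be 2.\<close>
  then have "i < 4" "j < 4" "i \<noteq> 3" "j \<noteq> 3"
    using big[of i j] x3 y3 by (auto simp: not_le[symmetric])
  with ij have "coeff (coeff f 2) 2 \<noteq> 0"
    by (cases "i = 2") auto
  \<comment> \<open>Each of the two summations extracts a quadratic coefficient with a minus sign;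
    the signs cancel.\<close>
  moreover have "(\<Sum>y\<in>UNIV. y * (\<Sum>x\<in>UNIV. x * eval2 f x y)) = coeff (coeff f 2) 2"
    unfolding eval2_def sum_poly_card_4(2)[OF card4 degx] polyC
    by (simp add: sum_negf sum_poly_card_4(2)[OF card4 degC] coeffC)
  ultimately show ?thesis
    by simp
qed

lemma LP44_isotopic:
  fixes f g :: "'a::{field,finite} poly poly"
  assumes card4: "card (UNIV :: 'a set) = 4" and "f \<in> LP44" and "g \<in> LP44"
  shows "isotopic f g"
proof -
  have cyclic: "\<exists>r c s. cyclic_square (eval2 p) r c s" if "p \<in> LP44" for p :: "'a poly poly"
  proof (rule cyclic_square_of_moment[OF card4])
    show "latin (eval2 p)"
      using that by (simp add: LP44_def LP4_def latin_def)
  qed (rule moment_of_LP44[OF card4 that])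
  then show ?thesis
    using cyclic_squares_isotopic[of "eval2 f" _ _ _ "eval2 g"] isotopicI[OF card4, of _ _ _ g f] assms(2,3)
    by metis
qed

text \<open>The polynomial x + y represents a class that is available even if \<open>LP44\<close> is
  empty.\<close>

lemma sum_of_variables_in_LP4:
  assumes "card (UNIV :: 'a::{field,finite} set) = 4"
  shows "([:[:0, 1:], 1:] :: 'a poly poly) \<in> LP4"
proof -
  let ?f = "[:[:0, 1:], 1:] :: 'a poly poly"
  have ev: "eval2 ?f = (\<lambda>x y. x + y)"
    by (intro ext) simp
  have small: "i \<le> 1 \<and> j \<le> 1" if "coeff (coeff ?f j) i \<noteq> 0" for i j
    using that by (auto simp: coeff_pCons split: nat.splits)
  have Max_less_4: "Max (insert 0 A) < 4" if "A \<subseteq> {..1}" for A :: "nat set"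
    using that finite_subset[OF that] by (subst Max_less_iff) auto
  have "degree_x ?f < 4" "degree_y ?f < 4"
    unfolding degree_x_def degree_y_def by (rule Max_less_4, use small in blast)+
  moreover have "bij (\<lambda>x. x + a)" "bij (\<lambda>x. a + x)" for a :: 'a
    by (rule bij_betw_byWitness[where f' = "\<lambda>x. x - a"]; simp)+
  ultimately show ?thesis
    unfolding LP4_def mem_Collect_eq ev by blast
qed

theorem theorem4p2:
  assumes "card (UNIV :: 'a::{field,finite} set) = 4"
  shows "(\<exists>C \<in> isotopism_classes. (LP44 :: 'a poly poly set) \<subseteq> C) \<and>
         (\<forall>f \<in> (LP44 :: 'a poly poly set). \<forall>g \<in> LP44. isotopic f g)"
proof -
  have iso: "\<forall>f \<in> (LP44 :: 'a poly poly set). \<forall>g \<in> LP44. isotopic f g"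
    using LP44_isotopic[OF assms] by blast
  have sub: "LP44 \<subseteq> (LP4 :: 'a poly poly set)"
    by (auto simp: LP44_def)
  have "\<exists>f \<in> (LP4 :: 'a poly poly set). \<forall>g \<in> LP44. isotopic f g"
  proof (cases "LP44 = ({} :: 'a poly poly set)")
    \<comment> \<open>Every class contains the empty set, so any member of \<open>LP4\<close> may
      represent one.\<close>
    case True
    then show ?thesis
      using sum_of_variables_in_LP4[OF assms] by (intro bexI) simp_all
  next
    case False
    then obtain f :: "'a poly poly" where "f \<in> LP44"
      by blast
    then show ?thesis
      using iso sub by (intro bexI[of _ f]) auto
  qed
  then obtain f :: "'a poly poly" where f: "f \<in> LP4" "\<forall>g \<in> LP44. isotopic f g" ..
  then have "LP44 \<subseteq> isotopism_rel `` {f}"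
    using sub by (auto simp: isotopism_rel_def)
  moreover have "isotopism_rel `` {f} \<in> isotopism_classes"
    using f(1) by (simp add: isotopism_classes_def quotientI)
  ultimately show ?thesis
    using iso by (intro conjI bexI)
qed

end
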